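(* Let $n\ge 2$, $\rho\in(0,1)$ and $p\in(0,1)$, and let $M$ be a positive integer with $M\ge \frac{8}{3\rho^2}\ln\frac{2n}{p}$. Let $u_1,\dots,u_M$ be independent random variables, each uniformly distributed on $[n-1]$, and let $W=\frac1M\sum_{i=1}^M A^{(u_i)}\in\mathbb{R}^{n\times n}$ (the D-EquiStatic weight matrix). Then with probability at least $1-p$, $$\|\Pi W x\|\le \rho\,\|\Pi x\|\qquad\text{for all } x\in\mathbb{R}^n .$$
   Context: Notation: $[m]=\{1,\dots,m\}$; $\|\cdot\|$ is the Euclidean norm; $\mathbf 1_n\in\mathbb{R}^n$ is the all-ones vector; $J=\frac1n\mathbf 1_n\mathbf 1_n^T$ and $\Pi=I-J$. The operation $i\bmod n$ returns the representative of $i$ modulo $n$ lying in $\{1,\dots,n\}$ (so multiples of $n$ are sent to $n$). Basis matrices: for $u\in[n-1]$, $A^{(u)}=[a^{(u)}_{ij}]\in\mathbb{R}^{n\times n}$ is defined by $a^{(u)}_{ij}=\frac{n-1}{n}$ if $i=(j+u)\bmod n$, $a^{(u)}_{ij}=\frac1n$ if $i=j$, and $a^{(u)}_{ij}=0$ otherwise. *)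

theory Defs
  imports "HOL-Probability.Probability"
begin

text \<open>Representative of \<open>m\<close> modulo \<open>n\<close> in \<open>{1..n}\<close>: multiples of \<open>n\<close> are sent to \<open>n\<close>, not to \<open>0\<close>.\<close>

definition mod_rep :: "nat \<Rightarrow> nat \<Rightarrow> nat" where
  "mod_rep m n = (if m mod n = 0 then n else m mod n)"

text \<open>Throughout, \<open>n = CARD('n)\<close>, and \<open>idx :: 'n \<Rightarrow> nat\<close> is meant to be a bijection from the
  index type \<open>'n\<close> onto \<open>{1..n}\<close>; it gives the rows and columns their numbers, on which the
  cyclic structure depends.\<close>

definition avg_mat :: "real ^ 'n ^ 'n" where
  "avg_mat = (\<chi> i j. 1 / real CARD('n))"

definition proj_mat :: "real ^ 'n ^ 'n" where
  "proj_mat = mat 1 - avg_mat"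

text \<open>For \<open>1 \<le> u < n\<close> the first two cases are disjoint; other values of \<open>u\<close> are not
  meaningful.\<close>

definition basis_mat :: "('n \<Rightarrow> nat) \<Rightarrow> nat \<Rightarrow> real ^ 'n ^ 'n" where
  "basis_mat idx u = (\<chi> i j.
     if idx i = mod_rep (idx j + u) CARD('n) then (real CARD('n) - 1) / real CARD('n)
     else if i = j then 1 / real CARD('n)
     else 0)"

definition equistatic_mat :: "('n \<Rightarrow> nat) \<Rightarrow> nat \<Rightarrow> (nat \<Rightarrow> nat) \<Rightarrow> real ^ 'n ^ 'n" where
  "equistatic_mat idx M u = (1 / real M) *\<^sub>R (\<Sum>i = 1..M. basis_mat idx (u i))"

end

theory Submission
  imports Defs
begin

text \<open>All basis matrices are circulant, so the discrete Fourier transform diagonalises them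
  simultaneously. The projection \<open>\<Pi>\<close> removes exactly the zeroth mode, so by
  Plancherel the contraction holds as soon as the eigenvalue of \<open>W\<close> at each mode \<open>k \<noteq> 0\<close> has modulus at most \<open>\<rho>\<close>. That eigenvalue is
  an average of \<open>M\<close> independent centred complex variables of modulus at most 1. Pinelis'
  inequality bounds the probability that its modulus reaches \<open>\<rho>\<close> by \<open>2 exp (- M \<rho>\<^sup>2 / 2) \<le> p / n\<close>,
  and a union bound over the \<open>n - 1\<close> modes finishes the proof.\<close>

subsection \<open>A Pinelis inequality for complex random variables\<close>

lemma cosh_even_series: "(\<lambda>n. x ^ (2 * n) / fact (2 * n)) sums cosh (x :: real)"
proof -
  let ?f = "\<lambda>n. if even n then x ^ n /\<^sub>R fact n else 0"
  have "strict_mono (\<lambda>n::nat. 2 * n)"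
    by (simp add: strict_mono_def)
  moreover have "?f n = 0" if "n \<notin> range (\<lambda>n. 2 * n)" for n
    using that by (auto elim!: evenE)
  ultimately have "(\<lambda>n. ?f (2 * n)) sums cosh x"
    using cosh_converges[of x] by (subst sums_mono_reindex) auto
  thus ?thesis
    by (simp add: field_simps)
qed

text \<open>Passing from \<open>n\<close> to \<open>Suc n\<close> multiplies the left side by
  \<open>2 * n + 2\<close> and the right side by \<open>(2 * n + 2) * (2 * n + 1)\<close>. This
  compares the Taylor coefficients of \<open>cosh x\<close> with those of
  \<open>exp (x\<^sup>2 / 2)\<close>.\<close>

lemma two_power_mult_fact_le: "2 ^ n * fact n \<le> (fact (2 * n) :: real)"
proof (induction n)
  case (Suc n)
  have "2 ^ Suc n * fact (Suc n) = (2 * real n + 2) * (2 ^ n * fact n)"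
    by (simp add: algebra_simps)
  also have "\<dots> \<le> (2 * real n + 2) * (2 * real n + 1) * fact (2 * n)"
    using Suc.IH by (subst mult.assoc, intro mult_left_mono) (auto intro: order.trans simp: algebra_simps)
  also have "\<dots> = fact (2 * Suc n)"
    by (simp add: algebra_simps)
  finally show ?case .
qed simp

lemma cosh_le_exp_square: "cosh x \<le> exp ((x :: real)\<^sup>2 / 2)"
proof (rule sums_le)
  show "(\<lambda>n. x ^ (2 * n) / fact (2 * n)) sums cosh x"
    by (rule cosh_even_series)
  show "(\<lambda>n. (x\<^sup>2 / 2) ^ n /\<^sub>R fact n) sums exp (x\<^sup>2 / 2)"
    by (rule exp_converges)
  show "x ^ (2 * n) / fact (2 * n) \<le> (x\<^sup>2 / 2) ^ n /\<^sub>R fact n" for n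
  proof -
    have "x ^ (2 * n) / fact (2 * n) \<le> x ^ (2 * n) / (2 ^ n * fact n)"
      by (intro divide_left_mono two_power_mult_fact_le) (auto simp: power_mult)
    also have "\<dots> = (x\<^sup>2 / 2) ^ n /\<^sub>R fact n"
      by (simp add: power_divide power_mult [symmetric] field_simps)
    finally show ?thesis .
  qed
qed

lemma convex_on_power_nonneg: "convex_on {0::real..} (\<lambda>x. x ^ n)"
  by (cases "even n")
     (auto intro: convex_power_odd convex_on_subset[OF convex_power_even])

text \<open>This is monotonicity and convexity of \<open>cosh \<circ> sqrt\<close>, stated without
  square roots. As a power series in \<open>x\<^sup>2\<close>, \<open>cosh x\<close> has nonnegative
  coefficients, and each power is increasing and convex on the nonnegative reals, so the bound holds
  term by term.\<close>

lemma cosh_le_convex_combination: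
  fixes x a b \<nu> \<mu> :: real
  assumes "\<nu> \<ge> 0" "\<mu> \<ge> 0" "\<nu> + \<mu> = 1" and x: "x\<^sup>2 \<le> \<nu> * a\<^sup>2 + \<mu> * b\<^sup>2"
  shows "cosh x \<le> \<nu> * cosh a + \<mu> * cosh b"
proof (rule sums_le)
  show "(\<lambda>n. x ^ (2 * n) / fact (2 * n)) sums cosh x"
    by (rule cosh_even_series)
  show "(\<lambda>n. \<nu> * (a ^ (2 * n) / fact (2 * n)) + \<mu> * (b ^ (2 * n) / fact (2 * n)))
          sums (\<nu> * cosh a + \<mu> * cosh b)"
    by (intro sums_add sums_mult cosh_even_series)
  show "x ^ (2 * n) / fact (2 * n)
          \<le> \<nu> * (a ^ (2 * n) / fact (2 * n)) + \<mu> * (b ^ (2 * n) / fact (2 * n))" for n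
  proof -
    have "(x\<^sup>2) ^ n \<le> (\<nu> * a\<^sup>2 + \<mu> * b\<^sup>2) ^ n"
      using x by (intro power_mono) auto
    also have "\<dots> \<le> \<nu> * (a\<^sup>2) ^ n + \<mu> * (b\<^sup>2) ^ n"
      using convex_on_power_nonneg[of n] assms(1-3) unfolding convex_on_def by auto
    finally have "x ^ (2 * n) / fact (2 * n) \<le> (\<nu> * a ^ (2 * n) + \<mu> * b ^ (2 * n)) / fact (2 * n)"
      by (intro divide_right_mono) (auto simp: power_mult)
    thus ?thesis
      by (simp add: add_divide_distrib)
  qed
qed

text \<open>Since \<open>cosh \<circ> sqrt\<close> is convex, \<open>cosh (\<theta> * norm (s + z))\<close> lies below its chord as a function of the
  component of \<open>z\<close> along \<open>s\<close>; the chord is affine in \<open>z\<close>, so its linear term averages out.\<close>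

lemma cosh_norm_add_le:
  fixes s z :: "'a :: real_inner"
  assumes z: "norm z \<le> 1"
  shows "cosh (\<theta> * norm (s + z))
           \<le> cosh (\<theta> * norm s) * cosh \<theta> + sinh \<theta> * sinh (\<theta> * norm s) * (sgn s \<bullet> z)"
proof -
  define w where "w = sgn s \<bullet> z"
  \<comment> \<open>For \<open>s = 0\<close> the convention \<open>sgn 0 = 0\<close> gives
    \<open>w = 0\<close>, and both sides vanish.\<close>
  have sw: "s \<bullet> z = norm s * w"
    by (cases "s = 0") (auto simp: w_def sgn_div_norm)
  have "\<bar>w\<bar> \<le> norm (sgn s) * norm z"
    unfolding w_def by (rule Cauchy_Schwarz_ineq2)
  also have "\<dots> \<le> 1"
    using z by (simp add: norm_sgn)
  finally have w: "-1 \<le> w" "w \<le> 1"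
    by auto
  have z2: "(norm z)\<^sup>2 \<le> 1"
    using z by (simp add: power_le_one)
  have "(norm (s + z))\<^sup>2 = (norm s)\<^sup>2 + (norm z)\<^sup>2 + 2 * norm s * w"
    using sw by (simp add: power2_norm_eq_inner inner_simps inner_commute)
  \<comment> \<open>The right side equals \<open>(norm s)\<^sup>2 + 1 + 2 * norm s * w\<close>: the
    nodes \<open>norm s + 1\<close> and \<open>norm s - 1\<close> are the extreme cases
    \<open>w = 1\<close> and \<open>w = -1\<close> for a unit vector \<open>z\<close>, and the
    weights have mean \<open>w\<close>.\<close>
  also have "\<dots> \<le> (1 + w) / 2 * (norm s + 1)\<^sup>2 + (1 - w) / 2 * (norm s - 1)\<^sup>2"
    using z2 by (simp add: power2_eq_square field_simps)
  finally have "\<theta>\<^sup>2 * (norm (s + z))\<^sup>2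
      \<le> \<theta>\<^sup>2 * ((1 + w) / 2 * (norm s + 1)\<^sup>2 + (1 - w) / 2 * (norm s - 1)\<^sup>2)"
    by (rule mult_left_mono) simp
  hence "(\<theta> * norm (s + z))\<^sup>2
      \<le> (1 + w) / 2 * (\<theta> * (norm s + 1))\<^sup>2 + (1 - w) / 2 * (\<theta> * (norm s - 1))\<^sup>2"
    by (simp only: power_mult_distrib distrib_left [of "\<theta>\<^sup>2"] mult.left_commute [of "\<theta>\<^sup>2"])
  hence "cosh (\<theta> * norm (s + z)) \<le> (1 + w) / 2 * cosh (\<theta> * (norm s + 1))
                                   + (1 - w) / 2 * cosh (\<theta> * (norm s - 1))"
    using w by (intro cosh_le_convex_combination) (auto simp: field_simps)
  also have "\<dots> = cosh (\<theta> * norm s) * cosh \<theta> + sinh \<theta> * sinh (\<theta> * norm s) * w"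
    by (simp add: ring_distribs cosh_add cosh_diff field_simps)
  finally show ?thesis
    by (simp add: w_def)
qed

section \<open>Moment and tail bounds for sums of independent complex variables\<close>

lemma borel_measurable_cosh [measurable]: "cosh \<in> borel_measurable (borel :: real measure)"
  by (intro borel_measurable_continuous_onI continuous_intros)

lemma borel_measurable_sinh [measurable]: "sinh \<in> borel_measurable (borel :: real measure)"
  by (intro borel_measurable_continuous_onI continuous_intros)

lemma norm_sum_le_card:
  assumes "\<And>i. i \<in> I \<Longrightarrow> norm (f i :: 'b :: real_normed_vector) \<le> 1"
  shows "norm (\<Sum>i\<in>I. f i) \<le> real (card I)"
  using sum_norm_le[of I f "\<lambda>_. 1"] assms by simp

context prob_space
begin

lemma integrable_cosh_norm:
  fixes f :: "'a \<Rightarrow> complex"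
  assumes [measurable]: "random_variable borel f"
    and bound: "\<And>\<omega>. norm (f \<omega>) \<le> B" and "\<theta> \<ge> 0"
  shows "integrable M (\<lambda>\<omega>. cosh (\<theta> * norm (f \<omega>)))"
proof (rule integrable_const_bound)
  show "AE \<omega> in M. norm (cosh (\<theta> * norm (f \<omega>))) \<le> cosh (\<theta> * B)"
    using bound \<open>\<theta> \<ge> 0\<close> order.trans[OF norm_ge_zero bound]
    by (intro AE_I2) (auto simp: cosh_real_nonneg_le_iff intro!: mult_left_mono)
qed measurable

lemma indep_var_sum_complex:
  fixes Z :: "'i \<Rightarrow> 'a \<Rightarrow> complex"
  assumes I: "finite I" "i \<notin> I" and indep: "indep_vars (\<lambda>_. borel) Z (insert i I)"
  shows "indep_var borel (\<lambda>\<omega>. \<Sum>j\<in>I. Z j \<omega>) borel (Z i)"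
proof -
  have "indep_var
    borel ((\<lambda>f. \<Sum>j\<in>I. f j) \<circ> (\<lambda>\<omega>. restrict (\<lambda>j. Z j \<omega>) I))
    borel ((\<lambda>f. f i) \<circ> (\<lambda>\<omega>. restrict (\<lambda>j. Z j \<omega>) {i}))"
    using I by (intro indep_var_compose[OF indep_var_restrict[OF indep]]) auto
  also have "((\<lambda>f. \<Sum>j\<in>I. f j) \<circ> (\<lambda>\<omega>. restrict (\<lambda>j. Z j \<omega>) I)) = (\<lambda>\<omega>. \<Sum>j\<in>I. Z j \<omega>)"
    by (auto cong: rev_conj_cong)
  also have "((\<lambda>f. f i) \<circ> (\<lambda>\<omega>. restrict (\<lambda>j. Z j \<omega>) {i})) = Z i"
    by auto
  finally show ?thesis .
qed

text \<open>The summands are added one at a time. By \<open>cosh_norm_add_le\<close> each new one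
  costs a factor \<open>cosh \<theta>\<close> plus a term linear in it, whose coefficient depends
  only on the earlier summands; independence and zero mean make that term vanish in
  expectation.\<close>

lemma expectation_cosh_norm_sum_le:
  fixes Z :: "'i \<Rightarrow> 'a \<Rightarrow> complex"
  assumes "finite I" "\<theta> \<ge> 0" "indep_vars (\<lambda>_. borel) Z I"
    and "\<And>i \<omega>. i \<in> I \<Longrightarrow> norm (Z i \<omega>) \<le> 1"
    and "\<And>i. i \<in> I \<Longrightarrow> expectation (Z i) = 0"
  shows "expectation (\<lambda>\<omega>. cosh (\<theta> * norm (\<Sum>i\<in>I. Z i \<omega>))) \<le> cosh \<theta> ^ card I"
  using assms(1,3-)
proof (induction I rule: finite_induct)
  case (insert i I)
  define S where "S = (\<lambda>\<omega>. \<Sum>j\<in>I. Z j \<omega>)"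
  \<comment> \<open>The inner product of complex numbers \<open>a\<close> and \<open>b\<close> is
    \<open>Re (cnj a * b)\<close>. The conjugate thus turns the linear term into the real part of a
    complex product, to which the product rule for independent variables applies.\<close>
  define c where "c = (\<lambda>s :: complex. cnj (sinh (\<theta> * norm s) *\<^sub>R sgn s))"
  have Z_meas: "random_variable borel (Z j)" if "j \<in> insert i I" for j
    using insert.prems(1) that by (auto simp: indep_vars_def)
  have [measurable]: "random_variable borel (Z i)" "random_variable borel S"
    unfolding S_def using Z_meas by auto
  have cnj_meas [measurable]: "cnj \<in> borel_measurable borel"
    by (intro borel_measurable_continuous_onI continuous_intros)
  have c_meas [measurable]: "c \<in> borel_measurable borel"
    unfolding c_def by measurable
  have S_bound: "norm (S \<omega>) \<le> real (card I)" for \<omega>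
    unfolding S_def using insert.prems(2) by (intro norm_sum_le_card) auto
  have Z_bound: "norm (Z i \<omega>) \<le> 1" for \<omega>
    using insert.prems(2) by auto
  have SZ_bound: "norm (S \<omega> + Z i \<omega>) \<le> real (card I) + 1" for \<omega>
    using norm_triangle_ineq[of "S \<omega>" "Z i \<omega>"] S_bound[of \<omega>] Z_bound[of \<omega>] by linarith
  have c_bound: "norm (c (S \<omega>)) \<le> sinh (\<theta> * real (card I))" for \<omega>
  proof -
    have "norm (c (S \<omega>)) \<le> sinh (\<theta> * norm (S \<omega>))"
      using \<open>\<theta> \<ge> 0\<close> by (simp add: c_def norm_sgn)
    also have "\<dots> \<le> sinh (\<theta> * real (card I))"
      using S_bound[of \<omega>] \<open>\<theta> \<ge> 0\<close> by (simp add: mult_left_mono)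
    finally show ?thesis .
  qed
  note int_S = integrable_cosh_norm[of S, OF _ S_bound \<open>\<theta> \<ge> 0\<close>]
  have int_c: "integrable M (\<lambda>\<omega>. c (S \<omega>))"
    using c_bound by (intro integrable_const_bound[of _ "sinh (\<theta> * real (card I))"]) auto
  have int_Z: "integrable M (Z i)"
    using Z_bound by (intro integrable_const_bound[of _ 1]) auto
  have indep: "indep_var borel (\<lambda>\<omega>. c (S \<omega>)) borel (Z i)"
  proof -
    have "indep_var borel (c \<circ> S) borel (id \<circ> Z i)"
      unfolding S_def using insert.prems(1) insert.hyps
      by (intro indep_var_compose[OF indep_var_sum_complex]) auto
    thus ?thesis by (simp add: o_def)
  qed
  have int_cZ: "integrable M (\<lambda>\<omega>. c (S \<omega>) * Z i \<omega>)"
    using indep_var_integrable[OF indep int_c int_Z] .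
  have "expectation (\<lambda>\<omega>. c (S \<omega>) * Z i \<omega>) = 0"
    using indep_var_lebesgue_integral[OF indep int_c int_Z] insert.prems(3)[of i] by simp
  hence E_cZ: "expectation (\<lambda>\<omega>. Re (c (S \<omega>) * Z i \<omega>)) = 0"
    using integral_Re[OF int_cZ] by (simp del: times_complex.sel)
  have "expectation (\<lambda>\<omega>. cosh (\<theta> * norm (S \<omega> + Z i \<omega>)))
      \<le> expectation (\<lambda>\<omega>. cosh \<theta> * cosh (\<theta> * norm (S \<omega>)) + sinh \<theta> * Re (c (S \<omega>) * Z i \<omega>))"
  proof (rule integral_mono)
    show "integrable M (\<lambda>\<omega>. cosh (\<theta> * norm (S \<omega> + Z i \<omega>)))"
      using SZ_bound \<open>\<theta> \<ge> 0\<close> by (intro integrable_cosh_norm) auto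
    show "integrable M (\<lambda>\<omega>. cosh \<theta> * cosh (\<theta> * norm (S \<omega>)) + sinh \<theta> * Re (c (S \<omega>) * Z i \<omega>))"
      using int_S int_cZ
      by (intro Bochner_Integration.integrable_add integrable_mult_right integrable_Re) auto
    show "cosh (\<theta> * norm (S \<omega> + Z i \<omega>))
        \<le> cosh \<theta> * cosh (\<theta> * norm (S \<omega>)) + sinh \<theta> * Re (c (S \<omega>) * Z i \<omega>)" for \<omega>
    proof -
      have "Re (c (S \<omega>) * Z i \<omega>) = sinh (\<theta> * norm (S \<omega>)) * (sgn (S \<omega>) \<bullet> Z i \<omega>)"
        by (simp add: c_def inner_complex_def algebra_simps)
      thus ?thesis
        using cosh_norm_add_le[OF Z_bound, of \<theta> "S \<omega>" \<omega>] by (simp add: algebra_simps)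
    qed
  qed
  also have "\<dots> = cosh \<theta> * expectation (\<lambda>\<omega>. cosh (\<theta> * norm (S \<omega>)))"
    using int_S integrable_Re[OF int_cZ] E_cZ
    by (subst Bochner_Integration.integral_add) (auto simp del: times_complex.sel)
  also have "\<dots> \<le> cosh \<theta> * cosh \<theta> ^ card I"
    unfolding S_def
    using insert.prems by (intro mult_left_mono insert.IH) (auto intro: indep_vars_subset)
  finally show ?case
    using insert.hyps by (simp add: S_def add.commute)
qed (simp add: prob_space)

text \<open>Chernoff's method with \<open>cosh (\<theta> * norm S)\<close> for the sum
  \<open>S\<close> in place of an exponential. The factor 2 arises from
  \<open>cosh y \<ge> exp y / 2\<close>, so real and imaginary parts need not be treated
  separately.\<close>

lemma Pinelis_inequality:
  fixes Z :: "'i \<Rightarrow> 'a \<Rightarrow> complex"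
  assumes "finite I" "I \<noteq> {}" "t > 0" and indep: "indep_vars (\<lambda>_. borel) Z I"
    and bound: "\<And>i \<omega>. i \<in> I \<Longrightarrow> norm (Z i \<omega>) \<le> 1"
    and mean: "\<And>i. i \<in> I \<Longrightarrow> expectation (Z i) = 0"
  shows "prob {\<omega> \<in> space M. norm (\<Sum>i\<in>I. Z i \<omega>) \<ge> t} \<le> 2 * exp (- t\<^sup>2 / (2 * card I))"
proof -
  define m where "m = real (card I)"
  \<comment> \<open>This value minimises the final exponent
    \<open>m * \<theta>\<^sup>2 / 2 - \<theta> * t\<close>.\<close>
  define \<theta> where "\<theta> = t / m"
  have m: "m > 0"
    using assms by (simp add: m_def card_gt_0_iff)
  hence \<theta>: "\<theta> > 0"
    using \<open>t > 0\<close> by (simp add: \<theta>_def)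
  have Z_meas [measurable]: "random_variable borel (Z j)" if "j \<in> I" for j
    using indep that by (auto simp: indep_vars_def)
  have S_bound: "norm (\<Sum>i\<in>I. Z i \<omega>) \<le> m" for \<omega>
    unfolding m_def using bound by (intro norm_sum_le_card) auto
  have int: "integrable M (\<lambda>\<omega>. cosh (\<theta> * norm (\<Sum>i\<in>I. Z i \<omega>)))"
    using S_bound \<theta> by (intro integrable_cosh_norm) auto
  have "prob {\<omega> \<in> space M. norm (\<Sum>i\<in>I. Z i \<omega>) \<ge> t}
      = prob {\<omega> \<in> space M. cosh (\<theta> * norm (\<Sum>i\<in>I. Z i \<omega>)) \<ge> cosh (\<theta> * t)}"
    using \<theta> \<open>t > 0\<close> by (simp add: cosh_real_nonneg_le_iff)
  also have "\<dots> \<le> expectation (\<lambda>\<omega>. cosh (\<theta> * norm (\<Sum>i\<in>I. Z i \<omega>))) / cosh (\<theta> * t)"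
    by (rule integral_Markov_inequality_measure[OF int, of "{}"]) auto
  also have "\<dots> \<le> exp (m * \<theta>\<^sup>2 / 2) / (exp (\<theta> * t) / 2)"
  proof (rule frac_le)
    have "expectation (\<lambda>\<omega>. cosh (\<theta> * norm (\<Sum>i\<in>I. Z i \<omega>))) \<le> cosh \<theta> ^ card I"
      using assms \<theta> by (intro expectation_cosh_norm_sum_le) auto
    also have "\<dots> \<le> exp (\<theta>\<^sup>2 / 2) ^ card I"
      by (intro power_mono cosh_le_exp_square) auto
    also have "\<dots> = exp (m * \<theta>\<^sup>2 / 2)"
      by (simp add: m_def exp_of_nat_mult [symmetric])
    finally show "expectation (\<lambda>\<omega>. cosh (\<theta> * norm (\<Sum>i\<in>I. Z i \<omega>))) \<le> exp (m * \<theta>\<^sup>2 / 2)" .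
  qed (auto simp: cosh_field_def)
  also have "\<dots> = 2 * exp (m * \<theta>\<^sup>2 / 2 - \<theta> * t)"
    by (simp add: exp_diff)
  also have "m * \<theta>\<^sup>2 / 2 - \<theta> * t = - t\<^sup>2 / (2 * card I)"
    using m unfolding \<theta>_def m_def by (simp add: field_simps power2_eq_square)
  finally show ?thesis .
qed

end

subsection \<open>The spectrum of the weight matrices\<close>

definition unity_root :: "nat \<Rightarrow> nat \<Rightarrow> complex" where
  "unity_root n k = cis (2 * pi * real k / real n)"

lemma unity_root_0 [simp]: "unity_root n 0 = 1"
  by (simp add: unity_root_def)

lemma norm_unity_root [simp]: "norm (unity_root n k) = 1"
  by (simp add: unity_root_def)

lemma unity_root_nonzero [simp]: "unity_root n k \<noteq> 0"
  by (simp add: unity_root_def)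

lemma unity_root_add: "unity_root n (a + b) = unity_root n a * unity_root n b"
  by (simp add: unity_root_def cis_mult add_divide_distrib distrib_left)

lemma unity_root_mult: "unity_root n (k * a) = unity_root n a ^ k"
  by (induction k) (auto simp: unity_root_add)

lemma unity_root_eq_iff:
  assumes "n > 0"
  shows "unity_root n a = unity_root n b \<longleftrightarrow> a mod n = b mod n"
  using complex_root_unity_eq[of n a b] assms
  by (simp add: unity_root_def cis_conv_exp mult_ac)

lemma sum_root_of_unity_powers:
  assumes "(z :: complex) ^ n = 1" "z \<noteq> 1"
  shows "(\<Sum>k<n. z ^ k) = 0"
  using geometric_sum[of z n] assms by simp

lemma sum_unity_root:
  assumes "0 < k" "k < n"
  shows "(\<Sum>m<n. unity_root n (k * m)) = 0"
proof -
  have "(\<Sum>m<n. unity_root n k ^ m) = 0"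
    using assms unity_root_eq_iff[of n "n * k" 0] unity_root_eq_iff[of n k 0]
    by (intro sum_root_of_unity_powers) (auto simp: unity_root_mult [symmetric])
  thus ?thesis
    by (simp add: unity_root_mult [symmetric] mult.commute)
qed

text \<open>Rows are numbered from 1 rather than 0; the shift by one only multiplies the sum by
  \<open>unity_root n k\<close>.\<close>

lemma sum_unity_root_shifted:
  assumes "0 < k" "k < n"
  shows "(\<Sum>m = 1..n. unity_root n (k * m)) = 0"
proof -
  have "(\<Sum>m = 1..n. unity_root n (k * m)) = (\<Sum>m<n. unity_root n (k * Suc m))"
    by (rule sum.reindex_bij_witness[of _ Suc "\<lambda>m. m - 1"]) auto
  also have "\<dots> = unity_root n k * (\<Sum>m<n. unity_root n (k * m))"
    by (simp add: sum_distrib_left unity_root_add)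
  finally show ?thesis
    using sum_unity_root[OF assms] by simp
qed

section \<open>Discrete Fourier transform, Plancherel identity and eigenvalues\<close>

definition dft :: "('n::finite \<Rightarrow> nat) \<Rightarrow> nat \<Rightarrow> real ^ 'n \<Rightarrow> complex" where
  "dft idx k x = (\<Sum>j\<in>UNIV. of_real (x $ j) * unity_root CARD('n) (k * idx j))"

lemma linear_dft: "linear (dft idx k)"
  by (rule linearI)
     (auto simp: dft_def algebra_simps sum.distrib sum_distrib_left scaleR_conv_of_real[where 'a = complex])

lemma mod_eq_imp_eq_on_interval:
  assumes "a \<in> {1..n}" "b \<in> {1..n}" "a mod n = b mod n"
  shows "a = (b :: nat)"
  using assms by (cases "a = n"; cases "b = n") auto

text \<open>The factor \<open>CARD('n)\<close> appears because \<open>dft\<close> is unnormalised.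
  The identity rests on orthogonality of the modes: the inner sum over \<open>k\<close> is a
  geometric sum of powers of an \<open>n\<close>-th root of unity, with \<open>n = CARD('n)\<close>,
  and this root is 1 only for \<open>i = j\<close> because \<open>{1..n}\<close> represents each
  residue once.\<close>

lemma Plancherel:
  fixes idx :: "'n::finite \<Rightarrow> nat" and x :: "real ^ 'n"
  assumes idx: "bij_betw idx UNIV {1..CARD('n)}"
  shows "(\<Sum>k<CARD('n). (norm (dft idx k x))\<^sup>2) = CARD('n) * (norm x)\<^sup>2"
proof -
  let ?n = "CARD('n)" and ?e = "unity_root CARD('n)"
  have orth: "(\<Sum>k<?n. ?e (k * idx i) * cnj (?e (k * idx j))) = (if i = j then of_nat ?n else 0)" for i j
  proof -
    define z where "z = ?e (idx i) * cnj (?e (idx j))"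
    have unit: "?e a * cnj (?e a) = 1" for a
      using complex_norm_square[of "?e a"] by simp
    have z: "?e (k * idx i) * cnj (?e (k * idx j)) = z ^ k" for k
      by (simp add: z_def unity_root_mult power_mult_distrib)
    have "z ^ ?n = 1"
      using unity_root_eq_iff[of ?n "?n * idx i" 0] unity_root_eq_iff[of ?n "?n * idx j" 0]
      by (simp add: z [symmetric])
    moreover have "i = j" if "z = 1"
    proof -
      have "?e (idx i) = ?e (idx i) * (?e (idx j) * cnj (?e (idx j)))"
        by (simp add: unit)
      also have "\<dots> = z * ?e (idx j)"
        by (simp add: z_def mult_ac)
      finally have "idx i mod ?n = idx j mod ?n"
        using that by (simp add: unity_root_eq_iff)
      hence "idx i = idx j"
        using bij_betwE[OF idx] by (blast intro: mod_eq_imp_eq_on_interval)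
      thus "i = j"
        using idx by (auto simp: bij_betw_def inj_on_def)
    qed
    moreover have "z = 1" if "i = j"
      using that by (simp add: z_def unit)
    ultimately show ?thesis
      unfolding z using sum_root_of_unity_powers[of z ?n] by auto
  qed
  have "of_real (\<Sum>k<?n. (norm (dft idx k x))\<^sup>2) = (\<Sum>k<?n. dft idx k x * cnj (dft idx k x))"
    by (simp only: of_real_sum complex_norm_square)
  also have "\<dots> = (\<Sum>k<?n. \<Sum>i\<in>UNIV. \<Sum>j\<in>UNIV. of_real (x $ i) * of_real (x $ j)
                     * (?e (k * idx i) * cnj (?e (k * idx j))))"
    by (simp only: dft_def sum_product cnj_sum complex_cnj_mult complex_cnj_complex_of_real)
       (simp only: mult_ac)
  also have "\<dots> = (\<Sum>i\<in>UNIV. \<Sum>j\<in>UNIV. \<Sum>k<?n. of_real (x $ i) * of_real (x $ j)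
                     * (?e (k * idx i) * cnj (?e (k * idx j))))"
    by (subst sum.swap) (rule sum.cong[OF refl], rule sum.swap)
  also have "\<dots> = (\<Sum>i\<in>UNIV. \<Sum>j\<in>UNIV. if i = j then of_nat ?n * of_real (x $ i) * of_real (x $ j) else 0)"
    unfolding sum_distrib_left [symmetric] orth by (intro sum.cong refl) auto
  also have "\<dots> = of_real (?n * (norm x)\<^sup>2)"
    by (simp add: norm_vec_def L2_set_def sum_nonneg sum_distrib_left power2_eq_square mult_ac)
  finally show ?thesis
    by (simp only: of_real_eq_iff)
qed

text \<open>The eigenvalue of \<open>basis_mat idx u\<close> at the \<open>k\<close>-th Fourier mode.\<close>

definition eigenval :: "nat \<Rightarrow> nat \<Rightarrow> nat \<Rightarrow> complex" where
  "eigenval n k u = of_real (1 / real n) + of_real ((real n - 1) / real n) * unity_root n (k * u)"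

text \<open>The eigenvalue is a convex combination of 1 and a point of the unit circle. This is the
  boundedness required by \<open>Pinelis_inequality\<close>.\<close>

lemma norm_eigenval_le_1:
  assumes "n > 0"
  shows "norm (eigenval n k u) \<le> 1"
proof -
  have "norm (eigenval n k u)
      \<le> norm (complex_of_real (1 / real n)) + norm (of_real ((real n - 1) / real n) * unity_root n (k * u))"
    unfolding eigenval_def by (rule norm_triangle_ineq)
  also have "\<dots> = 1"
    using assms by (simp only: norm_mult norm_of_real norm_unity_root) (simp add: field_simps)
  finally show ?thesis .
qed

text \<open>Without the term \<open>u = 0\<close> the roots of unity sum to -1, and the diagonal
  weight \<open>1 / n\<close> is exactly what compensates:
  \<open>(n - 1) / n - (n - 1) / n = 0\<close>. Hence the random eigenvalues are centred.\<close>

lemma sum_eigenval: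
  assumes "0 < k" "k < n"
  shows "(\<Sum>u = 1..n - 1. eigenval n k u) = 0"
proof -
  have "{..<n} = insert 0 {1..n - 1}"
    using assms by auto
  hence "1 + (\<Sum>u = 1..n - 1. unity_root n (k * u)) = 0"
    using sum_unity_root[OF assms] by simp
  hence "(\<Sum>u = 1..n - 1. unity_root n (k * u)) = -1"
    by (simp add: add_eq_0_iff)
  moreover have "(\<Sum>u = 1..n - 1. eigenval n k u)
      = of_nat (n - 1) * of_real (1 / real n)
        + of_real ((real n - 1) / real n) * (\<Sum>u = 1..n - 1. unity_root n (k * u))"
    by (simp only: eigenval_def sum.distrib sum_distrib_left sum_constant card_atLeastAtMost) simp
  ultimately show ?thesis
    using assms by (simp add: of_nat_diff)
qed

text \<open>Apart from the scaled identity, the matrix is a multiple of the cyclic shift by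
  \<open>u\<close>, and a shift multiplies mode \<open>k\<close> by
  \<open>unity_root n (k * u)\<close> with \<open>n = CARD('n)\<close>.\<close>

lemma dft_basis_mat:
  fixes idx :: "'n::finite \<Rightarrow> nat" and x :: "real ^ 'n"
  assumes idx: "bij_betw idx UNIV {1..CARD('n)}" and u: "u \<in> {1..CARD('n) - 1}"
  shows "dft idx k (basis_mat idx u *v x) = eigenval CARD('n) k u * dft idx k x"
proof -
  let ?n = "CARD('n)" and ?e = "unity_root CARD('n)"
  have column: "(\<Sum>i\<in>UNIV. of_real (basis_mat idx u $ i $ j) * ?e (k * idx i))
      = eigenval ?n k u * ?e (k * idx j)" for j
  proof -
    define m where "m = mod_rep (idx j + u) ?n"
    have "m \<in> {1..?n}"
      by (auto simp: m_def mod_rep_def Suc_le_eq intro: less_imp_le)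
    then obtain i' where i': "idx i' = m"
      using idx by (metis bij_betw_imp_surj_on imageE)
    have m_mod: "m mod ?n = (idx j + u) mod ?n"
      by (auto simp: m_def mod_rep_def)
    \<comment> \<open>Since \<open>u\<close> is not a multiple of \<open>CARD('n)\<close>, the
      shifted entry of column \<open>j\<close> lies off the diagonal, so the column splits into two
      separate single-entry contributions.\<close>
    have "i' \<noteq> j"
    proof
      assume "i' = j"
      hence "?e (idx j) = ?e (idx j) * ?e u"
        using m_mod i' by (simp add: unity_root_add [symmetric] unity_root_eq_iff)
      hence "?e u = ?e 0"
        by simp
      thus False
        using u by (subst (asm) unity_root_eq_iff) (auto dest: dvd_imp_le)
    qed
    have "?e (k * m) = ?e (k * (idx j + u))"
      using m_mod by (simp add: unity_root_eq_iff mod_mult_right_eq flip: mod_mult_right_eq[of k m])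
    hence e_m: "?e (k * idx i') = ?e (k * u) * ?e (k * idx j)"
      by (simp add: i' distrib_left unity_root_add)
    have "idx i = m \<longleftrightarrow> i = i'" for i
      using idx i' by (auto simp: bij_betw_def inj_on_def)
    hence "of_real (basis_mat idx u $ i $ j) * ?e (k * idx i)
        = (if i = i' then of_real ((real ?n - 1) / real ?n) * ?e (k * idx i) else 0)
          + (if i = j then of_real (1 / real ?n) * ?e (k * idx i) else 0)" for i
      using \<open>i' \<noteq> j\<close> by (auto simp: basis_mat_def m_def [symmetric])
    thus ?thesis
      by (simp add: sum.distrib e_m eigenval_def algebra_simps)
  qed
  have "dft idx k (basis_mat idx u *v x)
      = (\<Sum>i\<in>UNIV. \<Sum>j\<in>UNIV. of_real (x $ j) * (of_real (basis_mat idx u $ i $ j) * ?e (k * idx i)))"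
    by (simp only: dft_def matrix_vector_mult_def vec_lambda_beta of_real_sum of_real_mult
                   sum_distrib_right) (simp only: mult_ac)
  also have "\<dots> = (\<Sum>j\<in>UNIV. of_real (x $ j) * (eigenval ?n k u * ?e (k * idx j)))"
    by (subst sum.swap) (simp only: sum_distrib_left [symmetric] column)
  also have "\<dots> = eigenval ?n k u * dft idx k x"
    by (simp add: dft_def sum_distrib_left mult_ac)
  finally show ?thesis .
qed

section \<open>From eigenvalue bounds to contraction\<close>

lemma linear_matrix_vector_mult_left: "linear (\<lambda>A :: real ^ 'n ^ 'm. A *v x)"
  by (rule linearI)
     (auto simp: matrix_vector_mult_def vec_eq_iff algebra_simps sum.distrib sum_distrib_left)

lemma dft_equistatic_mat:
  fixes idx :: "'n::finite \<Rightarrow> nat" and x :: "real ^ 'n"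
  assumes idx: "bij_betw idx UNIV {1..CARD('n)}"
    and u: "\<And>i. i \<in> {1..M} \<Longrightarrow> u i \<in> {1..CARD('n) - 1}"
  shows "dft idx k (equistatic_mat idx M u *v x)
           = (1 / real M) *\<^sub>R (\<Sum>i = 1..M. eigenval CARD('n) k (u i)) * dft idx k x"
proof -
  have lin: "linear (\<lambda>A. dft idx k (A *v x))"
    using linear_compose[OF linear_matrix_vector_mult_left linear_dft] by (simp add: o_def)
  show ?thesis
    unfolding equistatic_mat_def
    by (simp add: linear_scale[OF lin] linear_sum[OF lin] dft_basis_mat[OF idx u] sum_distrib_right)
qed

text \<open>Averaging yields a constant vector, which has the same zeroth mode as \<open>x\<close>
  and no other modes.\<close>

lemma dft_proj_mat:
  fixes idx :: "'n::finite \<Rightarrow> nat" and x :: "real ^ 'n"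
  assumes idx: "bij_betw idx UNIV {1..CARD('n)}" and "k < CARD('n)"
  shows "dft idx k (proj_mat *v x) = (if k = 0 then 0 else dft idx k x)"
proof -
  let ?n = "CARD('n)" and ?e = "unity_root CARD('n)"
  define a where "a = (\<Sum>j\<in>UNIV. x $ j) / ?n"
  have "(avg_mat :: real ^ 'n ^ 'n) *v x = (\<chi> i. a)"
    by (simp add: avg_mat_def matrix_vector_mult_def a_def sum_divide_distrib)
  hence "dft idx k (proj_mat *v x) = dft idx k x - dft idx k (\<chi> i. a)"
    by (simp add: proj_mat_def matrix_vector_mult_diff_rdistrib linear_diff[OF linear_dft])
  also have "dft idx k (\<chi> i. a) = of_real a * (\<Sum>j\<in>UNIV. ?e (k * idx j))"
    by (simp add: dft_def sum_distrib_left)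
  also have "(\<Sum>j\<in>UNIV. ?e (k * idx j)) = (\<Sum>m = 1..?n. ?e (k * m))"
    using sum.reindex_bij_betw[OF idx] .
  also have "dft idx k x - of_real a * (\<Sum>m = 1..?n. ?e (k * m)) = (if k = 0 then 0 else dft idx k x)"
    using sum_unity_root_shifted[of k ?n] \<open>k < ?n\<close> by (auto simp: dft_def a_def)
  finally show ?thesis .
qed

text \<open>The deterministic core: Plancherel on both sides reduces the claim to single modes,
  where \<open>proj_mat\<close> kills mode 0 and the weight matrix multiplies every other mode by
  its averaged eigenvalue.\<close>

lemma equistatic_mat_contraction:
  fixes idx :: "'n::finite \<Rightarrow> nat" and x :: "real ^ 'n"
  assumes idx: "bij_betw idx UNIV {1..CARD('n)}"
    and u: "\<And>i. i \<in> {1..M} \<Longrightarrow> u i \<in> {1..CARD('n) - 1}"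
    and "\<rho> \<ge> 0"
    and bound: "\<And>k. k \<in> {1..CARD('n) - 1} \<Longrightarrow>
      norm (\<Sum>i = 1..M. eigenval CARD('n) k (u i)) \<le> \<rho> * real M"
  shows "norm (proj_mat *v (equistatic_mat idx M u *v x)) \<le> \<rho> * norm (proj_mat *v x)"
proof (rule power2_le_imp_le)
  let ?n = "CARD('n)" and ?W = "equistatic_mat idx M u"
  have "?n * (norm (proj_mat *v (?W *v x)))\<^sup>2 = (\<Sum>k<?n. (norm (dft idx k (proj_mat *v (?W *v x))))\<^sup>2)"
    by (rule Plancherel[OF idx, symmetric])
  also have "\<dots> \<le> (\<Sum>k<?n. (\<rho> * norm (dft idx k (proj_mat *v x)))\<^sup>2)"
  proof (intro sum_mono power_mono)
    fix k assume k: "k \<in> {..<?n}"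
    show "norm (dft idx k (proj_mat *v (?W *v x))) \<le> \<rho> * norm (dft idx k (proj_mat *v x))"
    proof (cases "k = 0")
      case False
      have "norm ((1 / real M) *\<^sub>R (\<Sum>i = 1..M. eigenval ?n k (u i))) \<le> \<rho>"
        \<comment> \<open>For \<open>M = 0\<close> the factor \<open>1 / real M\<close> is 0, so the
          norm is 0.\<close>
        using bound[of k] k False \<open>\<rho> \<ge> 0\<close> by (cases "M = 0") (auto simp: divide_simps)
      hence "norm (dft idx k (?W *v x)) \<le> \<rho> * norm (dft idx k x)"
        by (simp only: dft_equistatic_mat[OF idx u] norm_mult mult_right_mono norm_ge_zero)
      thus ?thesis
        using k False by (simp add: dft_proj_mat[OF idx])
    qed (use k in \<open>simp add: dft_proj_mat[OF idx]\<close>)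
  qed auto
  also have "\<dots> = ?n * (\<rho> * norm (proj_mat *v x))\<^sup>2"
    by (simp add: power_mult_distrib sum_distrib_left [symmetric] Plancherel[OF idx])
  finally show "(norm (proj_mat *v (?W *v x)))\<^sup>2 \<le> (\<rho> * norm (proj_mat *v x))\<^sup>2"
    by simp
qed (use \<open>\<rho> \<ge> 0\<close> in auto)

subsection \<open>Concentration of the eigenvalues\<close>

lemma expectation_eigenval:
  assumes "0 < k" "k < n"
  shows "measure_pmf.expectation (pmf_of_set {1..n - 1}) (eigenval n k) = 0"
proof -
  have ne: "{1..n - 1} \<noteq> {}"
    using assms by auto
  have "measure_pmf.expectation (pmf_of_set {1..n - 1}) (eigenval n k)
      = (\<Sum>u = 1..n - 1. pmf (pmf_of_set {1..n - 1}) u *\<^sub>R eigenval n k u)"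
    using ne by (intro integral_measure_pmf) auto
  also have "\<dots> = (1 / real (n - 1)) *\<^sub>R (\<Sum>u = 1..n - 1. eigenval n k u)"
    using ne unfolding scaleR_sum_right by (intro sum.cong) (auto simp: indicator_def)
  finally show ?thesis
    using sum_eigenval[OF assms] by simp
qed

text \<open>The event in the theorem quantifies over uncountably many \<open>x\<close>. As an
  intersection of closed conditions on the matrix it is still a Borel condition, which makes the
  event measurable.\<close>

lemma closed_contractions:
  "closed {A :: real ^ 'n ^ 'n. \<forall>x. norm (proj_mat *v (A *v x)) \<le> \<rho> * norm (proj_mat *v x)}"
proof (intro closed_Collect_all closed_Collect_le continuous_intros)
  show "continuous_on UNIV (\<lambda>A :: real ^ 'n ^ 'n. proj_mat *v (A *v x))" for x
  proof -
    have "linear ((\<lambda>y. proj_mat *v y) \<circ> (\<lambda>A :: real ^ 'n ^ 'n. A *v x))"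
      by (intro linear_compose linear_matrix_vector_mult_left matrix_vector_mul_linear)
    thus ?thesis
      by (intro linear_continuous_on) (simp add: linear_conv_bounded_linear o_def)
  qed
qed

theorem theorem1:
  fixes P :: "'w measure"
    and idx :: "'n::finite \<Rightarrow> nat"
    and n M :: nat
    and \<rho> p :: real
    and u :: "nat \<Rightarrow> 'w \<Rightarrow> nat"
  assumes "n = CARD('n)" and "n \<ge> 2"
    and "bij_betw idx UNIV {1..n}"
    and "0 < \<rho>" and "\<rho> < 1"
    and "0 < p" and "p < 1"
    and "M > 0"
    and "real M \<ge> 8 / (3 * \<rho>\<^sup>2) * ln (2 * real n / p)"
    and "prob_space P"
    and "prob_space.indep_vars P (\<lambda>_. count_space UNIV) u {1..M}"
    and "\<And>i. i \<in> {1..M} \<Longrightarrow>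
           distr P (count_space UNIV) (u i) = measure_pmf (pmf_of_set {1..n - 1})"
  shows "measure P {\<omega> \<in> space P. \<forall>x :: real ^ 'n.
           norm (proj_mat *v (equistatic_mat idx M (\<lambda>i. u i \<omega>) *v x)) \<le> \<rho> * norm (proj_mat *v x)}
         \<ge> 1 - p"
proof -
  interpret prob_space P by fact
  note n = assms(1,2) and idx = assms(3) and indep = assms(11) and unif = assms(12)
  let ?W = "\<lambda>\<omega>. equistatic_mat idx M (\<lambda>i. u i \<omega>)"
  define Good where "Good = {\<omega> \<in> space P. \<forall>x :: real ^ 'n.
    norm (proj_mat *v (?W \<omega> *v x)) \<le> \<rho> * norm (proj_mat *v x)}"
  define Bad where "Bad = (\<lambda>k. {\<omega> \<in> space P. norm (\<Sum>i = 1..M. eigenval n k (u i \<omega>)) \<ge> \<rho> * real M})"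
  have u_meas [measurable]: "random_variable (count_space UNIV) (u i)" if "i \<in> {1..M}" for i
    using indep that by (auto simp: indep_vars_def)
  have Bad_meas [measurable]: "Bad k \<in> events" for k
    unfolding Bad_def by measurable
  have "?W \<in> borel_measurable P"
    unfolding equistatic_mat_def
    by (intro borel_measurable_scaleR borel_measurable_const borel_measurable_sum
              measurable_compose[OF u_meas]) auto
  moreover have "Good = ?W -` {A. \<forall>x. norm (proj_mat *v (A *v x)) \<le> \<rho> * norm (proj_mat *v x)} \<inter> space P"
    by (auto simp: Good_def)
  ultimately have Good_meas: "Good \<in> events"
    by (simp only: measurable_sets borel_closed[OF closed_contractions])

  have "AE \<omega> in P. u i \<omega> \<in> {1..n - 1}" if "i \<in> {1..M}" for i
  proof -
    have "AE a in distr P (count_space UNIV) (u i). a \<in> {1..n - 1}"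
      unfolding unif[OF that] using n by (auto simp: AE_measure_pmf_iff)
    thus ?thesis
      using u_meas[OF that] by (subst (asm) AE_distr_iff) auto
  qed
  hence "AE \<omega> in P. \<forall>i\<in>{1..M}. u i \<omega> \<in> {1..n - 1}"
    by (intro AE_finite_allI) auto
  \<comment> \<open>Only the laws of the \<open>u i\<close> are prescribed, so their values lie in
    \<open>{1..n - 1}\<close> merely almost surely, and the inclusion of events holds up to a null
    set.\<close>
  hence AE_Good: "AE \<omega> in P. \<omega> \<in> space P - (\<Union>k\<in>{1..n - 1}. Bad k) \<longrightarrow> \<omega> \<in> Good"
  proof eventually_elim
    case (elim \<omega>)
    show ?case
    proof
      assume \<omega>: "\<omega> \<in> space P - (\<Union>k\<in>{1..n - 1}. Bad k)"
      have "norm (\<Sum>i = 1..M. eigenval n k (u i \<omega>)) \<le> \<rho> * real M" if "k \<in> {1..n - 1}" for k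
        using \<omega> that by (fastforce simp: Bad_def)
      thus "\<omega> \<in> Good"
        using \<omega> elim idx \<open>0 < \<rho>\<close> unfolding Good_def n(1)
        by (auto intro!: equistatic_mat_contraction)
    qed
  qed

  have prob_Bad: "prob (Bad k) \<le> p / n" if k: "k \<in> {1..n - 1}" for k
  proof -
    have "prob (Bad k) \<le> 2 * exp (- (\<rho> * real M)\<^sup>2 / (2 * card {1..M}))"
      unfolding Bad_def
    proof (rule Pinelis_inequality)
      show "indep_vars (\<lambda>_. borel) (\<lambda>i \<omega>. eigenval n k (u i \<omega>)) {1..M}"
        by (rule indep_vars_compose2[OF indep]) auto
      show "expectation (\<lambda>\<omega>. eigenval n k (u i \<omega>)) = 0" if "i \<in> {1..M}" for i
      proof -
        have "expectation (\<lambda>\<omega>. eigenval n k (u i \<omega>))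
            = integral\<^sup>L (distr P (count_space UNIV) (u i)) (eigenval n k)"
          using u_meas[OF that] by (subst integral_distr) auto
        also have "\<dots> = 0"
          unfolding unif[OF that] using k n by (intro expectation_eigenval) auto
        finally show ?thesis .
      qed
    qed (use n \<open>0 < \<rho>\<close> \<open>M > 0\<close> in \<open>auto intro: norm_eigenval_le_1\<close>)
    also have "- (\<rho> * real M)\<^sup>2 / (2 * card {1..M}) = - (\<rho>\<^sup>2 * M / 2)"
      using \<open>M > 0\<close> by (simp add: power2_eq_square)
    also have "exp (- (\<rho>\<^sup>2 * M / 2)) \<le> exp (- ln (2 * n / p))"
    proof -
      define l where "l = ln (2 * n / p)"
      have "l \<ge> 0"
        unfolding l_def using n \<open>0 < p\<close> \<open>p < 1\<close> by (intro ln_ge_zero) (simp add: divide_simps)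
      hence "l \<le> 4 / 3 * l"
        by simp
      also have "\<dots> = \<rho>\<^sup>2 * (8 / (3 * \<rho>\<^sup>2) * l) / 2"
        using \<open>0 < \<rho>\<close> by simp
      also have "\<dots> \<le> \<rho>\<^sup>2 * M / 2"
        using assms(9) unfolding l_def by (intro divide_right_mono mult_left_mono) auto
      finally show ?thesis
        by (simp add: l_def)
    qed
    also have "2 * exp (- ln (2 * n / p)) = p / n"
      using n \<open>0 < p\<close> by (simp add: exp_minus)
    finally show ?thesis
      by simp
  qed

  have "prob (\<Union>k\<in>{1..n - 1}. Bad k) \<le> (\<Sum>k\<in>{1..n - 1}. prob (Bad k))"
    by (intro finite_measure_subadditive_finite) auto
  also have "\<dots> \<le> (n - 1) * (p / n)"
    using sum_mono[of "{1..n - 1}", OF prob_Bad] by simp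
  also have "\<dots> \<le> n * (p / n)"
    using \<open>0 < p\<close> by (intro mult_right_mono) auto
  also have "\<dots> = p"
    using n by simp
  finally have "1 - p \<le> 1 - prob (\<Union>k\<in>{1..n - 1}. Bad k)"
    by simp
  also have "\<dots> = prob (space P - (\<Union>k\<in>{1..n - 1}. Bad k))"
    by (intro prob_compl [symmetric] sets.finite_UN) auto
  also have "\<dots> \<le> prob Good"
    by (rule finite_measure_mono_AE[OF AE_Good Good_meas])
  finally show ?thesis
    unfolding Good_def .
qed

end
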